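(* Let $X$ be a non-empty set, let $Y$ be a real or complex Hausdorff locally convex topological vector space, let $E$ be a closed subset of $Y$ such that $Y\setminus E$ is convex, let $I\subseteq\mathbf{R}$ be an interval, let $\lambda_0\in I$ and let $G:X\times I\to 2^Y$ be a multifunction. Assume that: $(i_1)$ for each $x\in X$, the multifunction $G(x,\cdot)$ is concave and continuous in $I$, and $G(x,\lambda)\subseteq Y\setminus E$ for some $\lambda\in I$; $(i_2)$ the set $\{x\in X : G(x,\lambda_0)\cap \mathrm{int}(E)\neq\emptyset\}$ is non-empty; $(i_3)$ there exists a set $D\subseteq I$ dense in $I$ such that, for every set $A\subseteq D$ for which $$\bigcap_{\lambda\in B\cup \{\lambda_0\}}\{x\in X : G(x,\lambda)\cap E\neq\emptyset\}\neq\emptyset$$ for each finite set $B\subseteq A$, one has $$\bigcap_{\lambda\in A\cup \{\lambda_0\}}\{x\in X : G(x,\lambda)\cap E\neq\emptyset\}\neq\emptyset .$$ Then there exist a compact interval $[a^*,b^*]\subseteq I$ and a point $x^*\in X$, with $G(x^*,\lambda_0)\cap E\neq\emptyset$ and $G(x^*,\lambda)\subseteq Y\setminus E$ for all $\lambda\in\,]a^*,b^*[$, such that, if we put $$V=\bigcup_{\lambda\in ]a^*,b^*[}\{x\in X : G(x,\lambda)\subseteq Y\setminus E\},$$ at least one of the following holds: $(p_1)$ $a^*>\lambda_0$, $G(x^*,a^* )\cap E\neq\emptyset$ and $G(V,a^* )\cap E\subseteq \partial G(V,a^* )\cap\partial E$; $(p_2)$ $b^*<\lambda_0$, $G(x^*,b^*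 )\cap E\neq\emptyset$ and $G(V,b^* )\cap E\subseteq \partial G(V,b^* )\cap\partial E$. In particular, $(p_1)$ (resp. $(p_2)$) holds when $\lambda_0=\inf I$ (resp. $\lambda_0=\sup I$).
   Context: An "interval" means a non-empty connected subset of $\mathbf{R}$ with more than one point (so $a^*<b^*$ for a compact interval $[a^*,b^*]$); $]a,b[$ denotes the open interval with endpoints $a,b$. A multifunction $F:S\to 2^T$ assigns to each $s\in S$ a (possibly empty) subset $F(s)$ of $T$. For a multifunction $F:S\to 2^T$, $A\subseteq S$ and $B\subseteq T$, put $F(A)=\bigcup_{s\in A}F(s)$, $F^{-}(B)=\{s\in S: F(s)\cap B\neq\emptyset\}$ and $F^{+}(B)=\{s\in S: F(s)\subseteq B\}$. In particular $G(V,\lambda)=\bigcup_{x\in V}G(x,\lambda)$. For topological spaces $S,T$, $F$ is lower semicontinuous if $F^{-}(\Omega)$ is open in $S$ for every open $\Omega\subseteq T$, upper semicontinuous if $F^{+}(\Omega)$ is open in $S$ for every open $\Omega\subseteq T$, and continuous if it is both. A multifunction $\Phi:I\to 2^Y$ is concave if $\Phi(t\lambda+(1-t)\mu)\subseteq t\Phi(\lambda)+(1-t)\Phi(\mu)$ for all $t\in[0,1]$, $\lambda,\mu\in I$ (Minkowski operations on sets). $\mathrm{int}$ and $\partial$ denote interior and boundary in $Y$. *)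

theory Defs
  imports "HOL-Analysis.Analysis" "HOL-Library.Set_Algebras"
begin

text \<open>
  A Hausdorff locally convex topological vector space over the reals or the complex numbers.
  By the Gelfand-Mazur theorem the scalar field \<open>'k\<close>, being a real normed field, is
  necessarily (a copy of) one of these two; for \<open>'k = real\<close> the scalar multiplication
  is forced to be \<open>(*\<^sub>R)\<close>. The Hausdorff property and the continuity of
  addition are part of the sort of \<open>'y\<close>. The real structure needed for
  \<open>convex\<close> is the restriction of the scalars.
\<close>

locale locally_convex_tvs = vector_space scale
  for scale :: "'k::real_normed_field \<Rightarrow> 'y::{real_vector, topological_ab_group_add, t2_space} \<Rightarrow> 'y" +
  assumes scale_of_real: "scale (of_real r) y = r *\<^sub>R y"
    and continuous_scale: "continuous_on UNIV (\<lambda>(c, y). scale c y)"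
    and locally_convex:
      "open (U :: 'y set) \<Longrightarrow> 0 \<in> U \<Longrightarrow> \<exists>C. convex C \<and> 0 \<in> interior C \<and> C \<subseteq> U"

text \<open>
  Multifunctions on \<open>S\<close> are set-valued functions, considered on the subspace \<open>S\<close>
  only; their values may be empty.
\<close>

definition lower_semicontinuous_multi_on ::
    "'a::topological_space set \<Rightarrow> ('a \<Rightarrow> 'b::topological_space set) \<Rightarrow> bool" where
  "lower_semicontinuous_multi_on S F \<longleftrightarrow>
     (\<forall>\<Omega>. open \<Omega> \<longrightarrow> openin (top_of_set S) {s \<in> S. F s \<inter> \<Omega> \<noteq> {}})"

definition upper_semicontinuous_multi_on ::
    "'a::topological_space set \<Rightarrow> ('a \<Rightarrow> 'b::topological_space set) \<Rightarrow> bool" where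
  "upper_semicontinuous_multi_on S F \<longleftrightarrow>
     (\<forall>\<Omega>. open \<Omega> \<longrightarrow> openin (top_of_set S) {s \<in> S. F s \<subseteq> \<Omega>})"

definition continuous_multi_on ::
    "'a::topological_space set \<Rightarrow> ('a \<Rightarrow> 'b::topological_space set) \<Rightarrow> bool" where
  "continuous_multi_on S F \<longleftrightarrow>
     lower_semicontinuous_multi_on S F \<and> upper_semicontinuous_multi_on S F"

text \<open>
  The sum of sets is the Minkowski sum. In particular \<open>t = 0\<close> and \<open>t = 1\<close> are
  not exempt, so a concave multifunction with one empty value has only empty values.
\<close>

definition concave_multi_on :: "real set \<Rightarrow> (real \<Rightarrow> 'b::real_vector set) \<Rightarrow> bool" where
  "concave_multi_on I \<Phi> \<longleftrightarrow>
     (\<forall>t\<in>{0..1}. \<forall>l\<in>I. \<forall>m\<in>I.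
        \<Phi> (t * l + (1 - t) * m) \<subseteq> ((*\<^sub>R) t ` \<Phi> l) + ((*\<^sub>R) (1 - t) ` \<Phi> m))"

end

theory Submission
  imports Defs
begin

text \<open>
  For \<open>x \<in> X\<close> let \<open>C x\<close> be the set of parameters \<open>l\<close> with \<open>G x l \<subseteq> UNIV - E\<close>. Concavity and upper
  semicontinuity make \<open>C x\<close> a non-empty relatively open subinterval of \<open>I\<close>. The point given by
  \<open>i2\<close> has \<open>l0\<close> outside the closure of its \<open>C x\<close>; say \<open>C x\<close> lies to the right of \<open>l0\<close>. Applied to
  \<open>A = D\<close>, the compactness property \<open>i3\<close> bounds the left endpoints of those \<open>C x\<close> that lie to the
  right of \<open>l0\<close>; applied to \<open>A = D \<inter> {..<a}\<close>, it shows that their supremum \<open>a\<close> is attained. Were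
  \<open>G y a\<close> to meet the interior of \<open>E\<close> for some \<open>y\<close> such that \<open>C y\<close> has points just after \<open>a\<close>,
  lower semicontinuity would push the left endpoint of \<open>C y\<close> beyond \<open>a\<close>. Finally, \<open>E\<close> is the
  closure of its interior, because its complement is convex and open, so missing the interior of
  \<open>E\<close> puts the points of \<open>E\<close> on both boundaries.
\<close>

section \<open>Scaling, interiors and boundaries in \<open>Y\<close>\<close>

lemma (in locally_convex_tvs) continuous_on_scaleR_tvs:
  assumes "continuous_on S f" "continuous_on S g"
  shows "continuous_on S (\<lambda>s. f s *\<^sub>R (g s :: 'y))"
proof -
  \<comment> \<open>Real scaling is \<open>scale\<close> restricted along \<open>of_real\<close>, so
    the joint continuity of \<open>scale\<close> passes to it.\<close>
  have "continuous_on S (\<lambda>s. (of_real (f s) :: 'k, g s))"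
    using assms by (intro continuous_intros)
  from continuous_on_compose2[OF continuous_scale this]
  show ?thesis by (simp add: scale_of_real)
qed

text \<open>Extend the segment from \<open>u\<close> to \<open>z\<close> slightly beyond
  \<open>z\<close>. The points reached are interior to the complement, since otherwise convexity
  would put \<open>z\<close> into \<open>U\<close>; they tend to \<open>z\<close> as
  \<open>e\<close> tends to 0.\<close>

lemma (in locally_convex_tvs) convex_open_compl_subset_closure_interior:
  fixes U :: "'y set"
  assumes "open U" "convex U" "u \<in> U"
  shows "- U \<subseteq> closure (interior (- U))"
proof
  fix z assume z: "z \<in> - U"
  have reflected: "z + e *\<^sub>R (z - u) \<in> interior (- U)" if e: "e > 0" for e :: real
  proof (rule interiorI)
    \<comment> \<open>\<open>h w\<close> lies on the line through \<open>w\<close> and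
      \<open>z\<close>, beyond \<open>z\<close>, placed so that \<open>z\<close> divides the segment
      from \<open>w\<close> to \<open>h w\<close> with weights \<open>1 / (1 + e)\<close> and
      \<open>e / (1 + e)\<close>. The extended point is sent to \<open>u\<close>.\<close>
    define h where "h = (\<lambda>w. z - (1 / e) *\<^sub>R (w - z))"
    have "continuous_on UNIV h"
      unfolding h_def by (intro continuous_intros continuous_on_scaleR_tvs)
    then show "open (h -` U)"
      using \<open>open U\<close> by (simp add: open_vimage)
    show "z + e *\<^sub>R (z - u) \<in> h -` U"
      using e \<open>u \<in> U\<close> by (simp add: h_def)
    show "h -` U \<subseteq> - U"
    proof
      fix w assume "w \<in> h -` U"
      then have hw: "h w \<in> U" by simp
      have "(1 + e) *\<^sub>R z = w + e *\<^sub>R h w"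
        using e by (simp add: h_def algebra_simps)
      then have "(1 / (1 + e)) *\<^sub>R ((1 + e) *\<^sub>R z) = (1 / (1 + e)) *\<^sub>R (w + e *\<^sub>R h w)"
        by simp
      then have "z = (1 / (1 + e)) *\<^sub>R w + (e / (1 + e)) *\<^sub>R h w"
        using e by (simp add: scaleR_add_right)
      moreover have "1 / (1 + e) + e / (1 + e) = 1"
        using e by (simp add: field_simps)
      ultimately show "w \<in> - U"
        using convexD[OF \<open>convex U\<close> _ hw, of w "1 / (1 + e)" "e / (1 + e)"] e z by auto
    qed
  qed
  show "z \<in> closure (interior (- U))"
  proof (rule ccontr)
    define T where "T = - closure (interior (- U))"
    assume "z \<notin> closure (interior (- U))"
    moreover have "open T" unfolding T_def by (intro open_Compl closed_closure)
    moreover have "continuous_on UNIV (\<lambda>e::real. z + e *\<^sub>R (z - u))"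
      by (intro continuous_intros continuous_on_scaleR_tvs)
    ultimately have "open ((\<lambda>e::real. z + e *\<^sub>R (z - u)) -` T)"
        and "0 \<in> (\<lambda>e::real. z + e *\<^sub>R (z - u)) -` T"
      by (simp_all add: open_vimage T_def)
    then obtain d where "d > 0" and d: "ball 0 d \<subseteq> (\<lambda>e::real. z + e *\<^sub>R (z - u)) -` T"
      using openE by metis
    have "d / 2 \<in> ball 0 d" using \<open>d > 0\<close> by simp
    with d have "z + (d / 2) *\<^sub>R (z - u) \<in> T" by blast
    moreover have "z + (d / 2) *\<^sub>R (z - u) \<in> interior (- U)"
      using reflected \<open>d > 0\<close> by simp
    ultimately show False
      using closure_subset unfolding T_def by blast
  qed
qed

text \<open>The open set \<open>interior H\<close> misses \<open>interior E\<close>, hence also its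
  closure, which contains \<open>E\<close>. So a point of \<open>H \<inter> E\<close> is interior
  neither to \<open>H\<close> nor to \<open>E\<close>.\<close>

lemma Int_subset_frontiers:
  assumes "closed E" "E \<subseteq> closure (interior E)" "H \<inter> interior E = {}"
  shows "H \<inter> E \<subseteq> frontier H \<inter> frontier E"
proof -
  have "interior H \<inter> closure (interior E) = {}"
    using assms(3) interior_subset[of H]
    by (subst open_Int_closure_eq_empty) auto
  then show ?thesis
    using assms closure_subset[of H] closure_subset[of E] by (auto simp: frontier_def)
qed

section \<open>Subsets of the parameter interval\<close>

lemma openin_meets_dense:
  assumes "openin (top_of_set S) W" "W \<noteq> {}" "S \<subseteq> closure D" "D \<subseteq> S"
  shows "D \<inter> W \<noteq> {}"
proof -
  obtain T where T: "open T" "W = S \<inter> T"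
    using assms(1) by (auto simp: openin_open)
  with assms have "T \<inter> closure D \<noteq> {}" by blast
  with T have "T \<inter> D \<noteq> {}"
    using open_Int_closure_eq_empty by blast
  with T assms show ?thesis by blast
qed

text \<open>A Minkowski convex combination of two subsets of the convex set \<open>U\<close> stays
  in \<open>U\<close>; on the real line, convex sets are the intervals.\<close>

lemma concave_multi_on_is_interval:
  assumes "concave_multi_on I \<Phi>" "convex U" "is_interval I"
  shows "is_interval {l \<in> I. \<Phi> l \<subseteq> U}"
proof -
  have "convex {l \<in> I. \<Phi> l \<subseteq> U}"
    unfolding convex_def
  proof (intro ballI allI impI)
    fix l m u v :: real
    assume l: "l \<in> {l \<in> I. \<Phi> l \<subseteq> U}" and m: "m \<in> {l \<in> I. \<Phi> l \<subseteq> U}"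
      and uv: "0 \<le> u" "0 \<le> v" "u + v = 1"
    have I: "u *\<^sub>R l + v *\<^sub>R m \<in> I"
      using assms(3) l m uv by (auto simp: is_interval_convex_1 convex_def)
    have v: "v = 1 - u" using uv by simp
    have "\<Phi> (u * l + v * m) \<subseteq> ((*\<^sub>R) u ` \<Phi> l) + ((*\<^sub>R) v ` \<Phi> m)"
      using assms(1) l m uv unfolding concave_multi_on_def v by auto
    also have "\<dots> \<subseteq> U"
    proof
      fix y assume "y \<in> ((*\<^sub>R) u ` \<Phi> l) + ((*\<^sub>R) v ` \<Phi> m)"
      then obtain p q where "y = u *\<^sub>R p + v *\<^sub>R q" "p \<in> \<Phi> l" "q \<in> \<Phi> m"
        by (auto elim!: set_plus_elim)
      with l m convexD[OF assms(2) _ _ uv] show "y \<in> U" by auto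
    qed
    finally show "u *\<^sub>R l + v *\<^sub>R m \<in> {l \<in> I. \<Phi> l \<subseteq> U}"
      using I by simp
  qed
  then show ?thesis by (simp add: is_interval_convex_1)
qed

section \<open>Extremal intervals on either side of \<open>l0\<close>\<close>

text \<open>Only real sets are involved here: \<open>C x\<close> stands for the parameters whose
  value misses \<open>E\<close>, \<open>N x\<close> for those whose value meets the interior of
  \<open>E\<close>, and \<open>fip\<close> for the compactness property \<open>i3\<close>.\<close>

lemma extremal_interval_right:
  fixes C N :: "'x \<Rightarrow> real set"
  assumes I: "is_interval I"
    and C: "\<And>x. x \<in> X \<Longrightarrow> is_interval (C x)" "\<And>x. x \<in> X \<Longrightarrow> openin (top_of_set I) (C x)"
      "\<And>x. x \<in> X \<Longrightarrow> C x \<noteq> {}"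
    and N: "\<And>x. x \<in> X \<Longrightarrow> openin (top_of_set I) (N x)" "\<And>x. x \<in> X \<Longrightarrow> C x \<inter> N x = {}"
    and l0: "l0 \<in> I"
    and D: "D \<subseteq> I" "I \<subseteq> closure D"
    and fip: "\<And>A. A \<subseteq> D \<Longrightarrow>
      (\<And>B. finite B \<Longrightarrow> B \<subseteq> A \<Longrightarrow> \<exists>x\<in>X. l0 \<notin> C x \<and> B \<inter> C x = {}) \<Longrightarrow>
      \<exists>x\<in>X. l0 \<notin> C x \<and> A \<inter> C x = {}"
    and x0: "x0 \<in> X" "l0 \<in> N x0" "C x0 \<subseteq> {l0<..}"
  shows "\<exists>a b x. l0 < a \<and> a < b \<and> {a..b} \<subseteq> I \<and> x \<in> X \<and> l0 \<notin> C x \<and> a \<notin> C x \<and>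
    {a<..<b} \<subseteq> C x \<and> (\<forall>y\<in>X. C y \<inter> {a<..<b} \<noteq> {} \<longrightarrow> a \<notin> N y)"
proof -
  have CI: "C x \<subseteq> I" if "x \<in> X" for x
    using C(2)[OF that] openin_imp_subset by blast
  have between: "r \<in> C x" if "x \<in> X" "p \<in> C x" "q \<in> C x" "p \<le> r" "r \<le> q" for x p q r
    by (rule mem_is_interval_1_I[OF C(1)[OF that(1)] that(2-)])
  \<comment> \<open>The lower bounds beyond \<open>l0\<close> of the various \<open>C x\<close>;
    their supremum will be the endpoint \<open>a\<close>.\<close>
  define L where "L = {l. l0 < l \<and> (\<exists>x\<in>X. C x \<subseteq> {l..})}"
  \<comment> \<open>A neighbourhood of \<open>l\<close> in \<open>I\<close> belongs to
    \<open>N y\<close> and so is free of points of \<open>C y\<close>. This gap makes the strict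
    bound \<open>l\<close> improvable.\<close>
  have pushed: "\<exists>e>0. C y \<subseteq> {l + e..}"
    if y: "y \<in> X" "l \<in> N y" "C y \<subseteq> {l<..}" for l y
  proof -
    obtain T where T: "open T" "N y = I \<inter> T"
      using N(1)[OF y(1)] by (auto simp: openin_open)
    then obtain e where e: "e > 0" "ball l e \<subseteq> T"
      using y(2) by (auto simp: open_contains_ball)
    have "l + e \<le> q" if "q \<in> C y" for q
    proof (rule ccontr)
      assume "\<not> l + e \<le> q"
      then have "q \<in> ball l e"
        using y(3) that by (auto simp: dist_real_def)
      then have "q \<in> N y" using T e CI y that by blast
      with N(2) y that show False by blast
    qed
    with e show ?thesis by auto
  qed
  obtain e0 where "e0 > 0" "C x0 \<subseteq> {l0 + e0..}"
    using pushed[OF x0] by blast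
  then have e0: "l0 + e0 \<in> L" using x0 by (auto simp: L_def)
  \<comment> \<open>Every \<open>C x\<close> meets the dense set \<open>D\<close>, so the conclusion
    of \<open>fip\<close> fails for \<open>A = D\<close>. Hence some finite \<open>B\<close> meets
    every \<open>C x\<close> that omits \<open>l0\<close>, and an upper bound of \<open>B\<close>
    bounds \<open>L\<close>.\<close>
  have "\<not> (\<exists>x\<in>X. l0 \<notin> C x \<and> D \<inter> C x = {})"
    using openin_meets_dense[OF C(2) C(3) D(2) D(1)] by blast
  then obtain B where B: "finite B" "\<not> (\<exists>x\<in>X. l0 \<notin> C x \<and> B \<inter> C x = {})"
    using fip[OF order_refl] by blast
  have bdd: "bdd_above L"
  proof -
    obtain m where m: "\<And>q. q \<in> B \<Longrightarrow> q \<le> m"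
      using bdd_above_finite[OF B(1)] by (auto simp: bdd_above_def)
    have "l \<le> m" if l: "l \<in> L" for l
    proof -
      obtain x where x: "x \<in> X" "C x \<subseteq> {l..}" and "l0 < l"
        using l by (auto simp: L_def)
      then obtain q where "q \<in> B" "q \<in> C x" using B(2) by force
      with x m[of q] show ?thesis by force
    qed
    then show ?thesis by (auto simp: bdd_above_def)
  qed
  define a where "a = Sup L"
  have upper: "l \<le> a" if "l \<in> L" for l
    unfolding a_def using bdd that by (rule cSup_upper[rotated])
  have l0a: "l0 < a" using upper[OF e0] \<open>e0 > 0\<close> by simp
  \<comment> \<open>A finite set below \<open>a\<close> lies below some element of \<open>L\<close>,
    whose witness avoids it. Inserting \<open>l0\<close> keeps \<open>Max\<close> meaningful for an
    empty set.\<close>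
  have "\<exists>x\<in>X. l0 \<notin> C x \<and> (D \<inter> {..<a}) \<inter> C x = {}"
  proof (rule fip)
    fix B assume B: "finite B" "B \<subseteq> D \<inter> {..<a}"
    then have "Max (insert l0 B) < a" using l0a by (subst Max_less_iff) auto
    then obtain l where l: "l \<in> L" "Max (insert l0 B) < l"
      unfolding a_def using less_cSup_iff[OF _ bdd] e0 by blast
    then have "\<forall>q\<in>insert l0 B. q < l" using B by (simp add: Max_less_iff)
    with l show "\<exists>x\<in>X. l0 \<notin> C x \<and> B \<inter> C x = {}"
      unfolding L_def by fastforce
  qed auto
  then obtain x where x: "x \<in> X" "l0 \<notin> C x" "(D \<inter> {..<a}) \<inter> C x = {}" by blast
  have Cxa: "C x \<subseteq> {a..}"
  proof -
    have "openin (top_of_set I) (C x \<inter> {..<a})"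
      using C(2)[OF x(1)] by (simp add: openin_Int_open)
    then have "C x \<inter> {..<a} = {}"
      using openin_meets_dense[OF _ _ D(2) D(1)] x(3) by blast
    then show ?thesis by (auto simp: not_less)
  qed
  obtain p where p: "p \<in> C x" using C(3)[OF x(1)] by blast
  have "a \<le> p" "p \<in> I" using p Cxa CI[OF x(1)] by auto
  then have acI: "{l0..p} \<subseteq> I"
    using mem_is_interval_1_I[OF I l0] by auto
  have aC: "a \<notin> C x"
  proof
    assume a: "a \<in> C x"
    obtain T where T: "open T" "C x = I \<inter> T"
      using C(2)[OF x(1)] by (auto simp: openin_open)
    with a obtain e where e: "e > 0" "ball a e \<subseteq> T"
      by (auto simp: open_contains_ball)
    \<comment> \<open>A point just left of \<open>a\<close>; the maximum with \<open>l0\<close>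
      keeps it inside \<open>I\<close>.\<close>
    define q where "q = max l0 (a - e / 2)"
    have "q \<in> ball a e" "l0 \<le> q" "q < a"
      using e l0a by (auto simp: q_def dist_real_def)
    then have "q \<in> C x" using T e acI \<open>a \<le> p\<close> by auto
    with Cxa \<open>q < a\<close> show False by auto
  qed
  then have "a < p" using p \<open>a \<le> p\<close> by (cases "a = p") auto
  \<comment> \<open>A missing point \<open>l\<close> would leave the interval \<open>C x\<close>,
    which contains \<open>p\<close>, entirely to the right of \<open>l\<close>. Then
    \<open>l\<close> would be an element of \<open>L\<close> above its supremum.\<close>
  have sub: "{a<..<p} \<subseteq> C x"
  proof (rule subsetI, rule ccontr)
    fix l assume l: "l \<in> {a<..<p}" "l \<notin> C x"
    have "C x \<subseteq> {l..}"
      using l between[OF x(1) _ p, of _ l] by force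
    then have "l \<in> L" using l l0a x by (auto simp: L_def)
    with upper l show False by force
  qed
  have "a \<notin> N y" if y: "y \<in> X" "C y \<inter> {a<..<p} \<noteq> {}" for y
  proof
    assume a: "a \<in> N y"
    then have "a \<notin> C y" using N(2) y by blast
    obtain q where q: "q \<in> C y" "a < q" using y by auto
    have "C y \<subseteq> {a<..}"
      using \<open>a \<notin> C y\<close> q between[OF y(1) _ q(1), of _ a] by force
    with pushed[OF y(1) a] obtain e where "e > 0" "C y \<subseteq> {a + e..}" by blast
    then have "a + e \<in> L" using l0a y by (auto simp: L_def)
    with upper \<open>e > 0\<close> show False by force
  qed
  with l0a \<open>a < p\<close> acI x aC sub show ?thesis
    by (intro exI[of _ a] exI[of _ p] exI[of _ x]) auto
qed

text \<open>The reflection \<open>uminus\<close> exchanges the two sides of \<open>l0\<close> and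
  preserves intervals, relative openness and density.\<close>

lemma extremal_interval_left:
  fixes C N :: "'x \<Rightarrow> real set"
  assumes I: "is_interval I"
    and C: "\<And>x. x \<in> X \<Longrightarrow> is_interval (C x)" "\<And>x. x \<in> X \<Longrightarrow> openin (top_of_set I) (C x)"
      "\<And>x. x \<in> X \<Longrightarrow> C x \<noteq> {}"
    and N: "\<And>x. x \<in> X \<Longrightarrow> openin (top_of_set I) (N x)" "\<And>x. x \<in> X \<Longrightarrow> C x \<inter> N x = {}"
    and l0: "l0 \<in> I"
    and D: "D \<subseteq> I" "I \<subseteq> closure D"
    and fip: "\<And>A. A \<subseteq> D \<Longrightarrow>
      (\<And>B. finite B \<Longrightarrow> B \<subseteq> A \<Longrightarrow> \<exists>x\<in>X. l0 \<notin> C x \<and> B \<inter> C x = {}) \<Longrightarrow>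
      \<exists>x\<in>X. l0 \<notin> C x \<and> A \<inter> C x = {}"
    and x0: "x0 \<in> X" "l0 \<in> N x0" "C x0 \<subseteq> {..<l0}"
  shows "\<exists>a b x. b < l0 \<and> a < b \<and> {a..b} \<subseteq> I \<and> x \<in> X \<and> l0 \<notin> C x \<and> b \<notin> C x \<and>
    {a<..<b} \<subseteq> C x \<and> (\<forall>y\<in>X. C y \<inter> {a<..<b} \<noteq> {} \<longrightarrow> b \<notin> N y)"
proof -
  have mem: "r \<in> uminus ` S \<longleftrightarrow> - r \<in> S" for r :: real and S
    by force
  have open_neg: "openin (top_of_set (uminus ` I)) (uminus ` W)"
    if "openin (top_of_set I) W" for W :: "real set"
  proof -
    obtain T where "open T" "W = I \<inter> T" using \<open>openin (top_of_set I) W\<close> by (auto simp: openin_open)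
    moreover have "uminus ` (I \<inter> T) = uminus ` I \<inter> uminus ` T" by auto
    ultimately show ?thesis using open_negations[of T] by (auto simp: openin_open)
  qed
  have "\<exists>a b x. - l0 < a \<and> a < b \<and> {a..b} \<subseteq> uminus ` I \<and> x \<in> X \<and>
    - l0 \<notin> uminus ` C x \<and> a \<notin> uminus ` C x \<and> {a<..<b} \<subseteq> uminus ` C x \<and>
    (\<forall>y\<in>X. uminus ` C y \<inter> {a<..<b} \<noteq> {} \<longrightarrow> a \<notin> uminus ` N y)"
  proof (rule extremal_interval_right[where D = "uminus ` D" and ?x0.0 = x0])
    show "uminus ` I \<subseteq> closure (uminus ` D)"
      using image_mono[OF D(2), of uminus] closure_scaleR[of "- 1" D] by simp
    show "\<exists>x\<in>X. - l0 \<notin> uminus ` C x \<and> A \<inter> uminus ` C x = {}"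
      if A: "A \<subseteq> uminus ` D"
        and *: "\<And>B. finite B \<Longrightarrow> B \<subseteq> A \<Longrightarrow> \<exists>x\<in>X. - l0 \<notin> uminus ` C x \<and> B \<inter> uminus ` C x = {}"
      for A
    proof -
      have "\<exists>x\<in>X. l0 \<notin> C x \<and> uminus ` A \<inter> C x = {}"
      proof (rule fip)
        show "uminus ` A \<subseteq> D" using A by auto
        fix B assume "finite B" "B \<subseteq> uminus ` A"
        then have "finite (uminus ` B)" "uminus ` B \<subseteq> A" by auto
        from *[OF this] show "\<exists>x\<in>X. l0 \<notin> C x \<and> B \<inter> C x = {}" by auto
      qed
      then show ?thesis by fastforce
    qed
    show "uminus ` C x \<inter> uminus ` N x = {}" if "x \<in> X" for x
      using N(2)[OF that] by auto
    show "uminus ` C x0 \<subseteq> {- l0<..}" using x0(3) by auto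
  qed (use I C N l0 D x0 in \<open>auto simp: open_neg\<close>)
  then obtain a b x where ab: "- l0 < a" "a < b" "{a..b} \<subseteq> uminus ` I" "x \<in> X"
      "- l0 \<notin> uminus ` C x" "a \<notin> uminus ` C x" "{a<..<b} \<subseteq> uminus ` C x"
      "\<forall>y\<in>X. uminus ` C y \<inter> {a<..<b} \<noteq> {} \<longrightarrow> a \<notin> uminus ` N y"
    by blast
  \<comment> \<open>Reflecting back turns the extremal left endpoint \<open>a\<close> into the right
    endpoint \<open>- a\<close>.\<close>
  have "{- b..- a} \<subseteq> I"
  proof
    fix r assume "r \<in> {- b..- a}"
    then have "- r \<in> {a..b}" by auto
    with ab(3) have "- r \<in> uminus ` I" by blast
    then show "r \<in> I" by auto
  qed
  moreover have "{- b<..<- a} \<subseteq> C x"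
  proof
    fix r assume "r \<in> {- b<..<- a}"
    then have "- r \<in> {a<..<b}" by auto
    with ab(7) have "- r \<in> uminus ` C x" by blast
    then show "r \<in> C x" by auto
  qed
  moreover have "- a \<notin> N y" if "y \<in> X" "C y \<inter> {- b<..<- a} \<noteq> {}" for y
  proof -
    from that(2) obtain r where "r \<in> C y" "- b < r" "r < - a" by auto
    then have "- r \<in> uminus ` C y \<inter> {a<..<b}" by auto
    with ab(8) that(1) have "a \<notin> uminus ` N y" by blast
    then show ?thesis by (simp add: mem)
  qed
  ultimately show ?thesis
    using ab(1,2,4,5,6) by (intro exI[of _ "- b"] exI[of _ "- a"] exI[of _ x]) (auto simp: mem)
qed

section \<open>Translation between the multifunction and its parameter sets\<close>

theorem theorem1:
  fixes X :: "'x set"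
    and scale :: "'k::real_normed_field \<Rightarrow> 'y::{real_vector, topological_ab_group_add, t2_space} \<Rightarrow> 'y"
    and E :: "'y set"
    and I :: "real set"
    and l0 :: real
    and G :: "'x \<Rightarrow> real \<Rightarrow> 'y set"
  assumes X_nonempty: "X \<noteq> {}"
    and Y_lctvs: "locally_convex_tvs scale"
    and E_closed: "closed E"
    and E_compl_convex: "convex (UNIV - E)"
    and I_interval: "connected I" "\<exists>l\<in>I. \<exists>m\<in>I. l \<noteq> m"
    and l0_in: "l0 \<in> I"
    and i1: "\<forall>x\<in>X. concave_multi_on I (G x) \<and> continuous_multi_on I (G x) \<and>
               (\<exists>l\<in>I. G x l \<subseteq> UNIV - E)"
    and i2: "{x \<in> X. G x l0 \<inter> interior E \<noteq> {}} \<noteq> {}"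
    and i3: "\<exists>D. D \<subseteq> I \<and> I \<subseteq> closure D \<and>
               (\<forall>A. A \<subseteq> D \<longrightarrow>
                  (\<forall>B. finite B \<and> B \<subseteq> A \<longrightarrow>
                     (\<Inter>l\<in>B \<union> {l0}. {x \<in> X. G x l \<inter> E \<noteq> {}}) \<noteq> {}) \<longrightarrow>
                  (\<Inter>l\<in>A \<union> {l0}. {x \<in> X. G x l \<inter> E \<noteq> {}}) \<noteq> {})"
  shows "\<exists>a b x.
           a < b \<and> {a..b} \<subseteq> I \<and> x \<in> X \<and>
           G x l0 \<inter> E \<noteq> {} \<and>
           (\<forall>l\<in>{a<..<b}. G x l \<subseteq> UNIV - E) \<and>
           (let V = (\<Union>l\<in>{a<..<b}. {x \<in> X. G x l \<subseteq> UNIV - E});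
                GV = (\<lambda>l. \<Union>y\<in>V. G y l);
                p1 = (a > l0 \<and> G x a \<inter> E \<noteq> {} \<and>
                      GV a \<inter> E \<subseteq> frontier (GV a) \<inter> frontier E);
                p2 = (b < l0 \<and> G x b \<inter> E \<noteq> {} \<and>
                      GV b \<inter> E \<subseteq> frontier (GV b) \<inter> frontier E)
            in (p1 \<or> p2) \<and>
               (bdd_below I \<and> l0 = Inf I \<longrightarrow> p1) \<and>
               (bdd_above I \<and> l0 = Sup I \<longrightarrow> p2))"
proof -
  interpret locally_convex_tvs scale by (rule Y_lctvs)
  have I: "is_interval I" using I_interval(1) by (simp add: is_interval_connected_1)
  define C where "C = (\<lambda>x. {l \<in> I. G x l \<subseteq> UNIV - E})"
  define N where "N = (\<lambda>x. {l \<in> I. G x l \<inter> interior E \<noteq> {}})"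
  have notC: "l \<notin> C x \<longleftrightarrow> G x l \<inter> E \<noteq> {}" if "l \<in> I" for l x
    using that by (auto simp: C_def)
  have C_interval: "is_interval (C x)" if "x \<in> X" for x
    unfolding C_def using i1 that E_compl_convex I concave_multi_on_is_interval by blast
  have "open (UNIV - E)" using E_closed by (simp add: open_Diff)
  then have C_open: "openin (top_of_set I) (C x)" if "x \<in> X" for x
    unfolding C_def using i1 that
    by (auto simp: continuous_multi_on_def upper_semicontinuous_multi_on_def)
  have C_ne: "C x \<noteq> {}" if "x \<in> X" for x
    using i1 that by (auto simp: C_def)
  have N_open: "openin (top_of_set I) (N x)" if "x \<in> X" for x
    unfolding N_def using i1 that
    by (auto simp: continuous_multi_on_def lower_semicontinuous_multi_on_def)
  have CN: "C x \<inter> N x = {}" for x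
    using interior_subset[of E] by (auto simp: C_def N_def)
  obtain D where D: "D \<subseteq> I" "I \<subseteq> closure D"
    and fip: "\<And>A. A \<subseteq> D \<Longrightarrow>
      (\<forall>B. finite B \<and> B \<subseteq> A \<longrightarrow> (\<Inter>l\<in>B \<union> {l0}. {x \<in> X. G x l \<inter> E \<noteq> {}}) \<noteq> {}) \<Longrightarrow>
      (\<Inter>l\<in>A \<union> {l0}. {x \<in> X. G x l \<inter> E \<noteq> {}}) \<noteq> {}"
    using i3 by auto
  \<comment> \<open>The restriction to subsets of \<open>D\<close> keeps all parameters in
    \<open>I\<close>, where omission from \<open>C x\<close> means exactly that the value meets
    \<open>E\<close>.\<close>
  have Inter_iff: "(\<Inter>l\<in>B \<union> {l0}. {x \<in> X. G x l \<inter> E \<noteq> {}}) \<noteq> {} \<longleftrightarrow>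
      (\<exists>x\<in>X. l0 \<notin> C x \<and> B \<inter> C x = {})" if "B \<subseteq> D" for B
  proof -
    have "B \<union> {l0} \<subseteq> I" using that D(1) l0_in by blast
    then have "{x \<in> X. G x l \<inter> E \<noteq> {}} = {x \<in> X. l \<notin> C x}" if "l \<in> B \<union> {l0}" for l
      using notC that by blast
    then have "(\<Inter>l\<in>B \<union> {l0}. {x \<in> X. G x l \<inter> E \<noteq> {}}) = (\<Inter>l\<in>B \<union> {l0}. {x \<in> X. l \<notin> C x})"
      by (rule INF_cong[OF refl])
    also have "\<dots> = {x \<in> X. l0 \<notin> C x \<and> B \<inter> C x = {}}" by auto
    finally show ?thesis by blast
  qed
  have fip': "\<exists>x\<in>X. l0 \<notin> C x \<and> A \<inter> C x = {}"
    if "A \<subseteq> D" and *: "\<And>B. finite B \<Longrightarrow> B \<subseteq> A \<Longrightarrow> \<exists>x\<in>X. l0 \<notin> C x \<and> B \<inter> C x = {}" for A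
  proof -
    have "(\<Inter>l\<in>B \<union> {l0}. {x \<in> X. G x l \<inter> E \<noteq> {}}) \<noteq> {}" if "finite B \<and> B \<subseteq> A" for B
      using Inter_iff[of B] \<open>A \<subseteq> D\<close> that *[of B] by blast
    then show ?thesis
      using fip[OF \<open>A \<subseteq> D\<close>] Inter_iff[OF \<open>A \<subseteq> D\<close>] by simp
  qed
  obtain x0 where x0: "x0 \<in> X" "l0 \<in> N x0"
    using i2 l0_in by (auto simp: N_def)
  \<comment> \<open>The reflection argument needs a point \<open>u\<close> of the complement, so
    \<open>E = UNIV\<close> is treated separately.\<close>
  have E_reg: "E \<subseteq> closure (interior E)"
  proof (cases "E = UNIV")
    case False
    then obtain u where "u \<in> UNIV - E" by blast
    from convex_open_compl_subset_closure_interior[OF \<open>open (UNIV - E)\<close> E_compl_convex this]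
    show ?thesis by (simp add: Compl_eq_Diff_UNIV[symmetric])
  qed simp
  \<comment> \<open>The point \<open>c\<close> will be \<open>a\<close> in one case and
    \<open>b\<close> in the other. Membership of \<open>y\<close> in \<open>V\<close> says that
    \<open>C y\<close> meets the open interval, so extremality gives
    \<open>c \<notin> N y\<close>.\<close>
  have frontiers: "(\<Union>y\<in>V. G y c) \<inter> E \<subseteq> frontier (\<Union>y\<in>V. G y c) \<inter> frontier E"
    if "c \<in> I" "V = (\<Union>l\<in>{a<..<b}. {x \<in> X. G x l \<subseteq> UNIV - E})" "{a..b} \<subseteq> I"
      and c: "\<forall>y\<in>X. C y \<inter> {a<..<b} \<noteq> {} \<longrightarrow> c \<notin> N y" for a b c V
  proof (rule Int_subset_frontiers[OF E_closed E_reg])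
    have "G y c \<inter> interior E = {}" if y: "y \<in> V" for y
    proof -
      obtain l where "l \<in> {a<..<b}" "y \<in> X" "G y l \<subseteq> UNIV - E"
        using y \<open>V = _\<close> by auto
      moreover from this \<open>{a..b} \<subseteq> I\<close> have "l \<in> C y"
        by (auto simp: C_def)
      ultimately have "c \<notin> N y" using c by blast
      with \<open>c \<in> I\<close> show ?thesis by (simp add: N_def)
    qed
    then show "(\<Union>y\<in>V. G y c) \<inter> interior E = {}" by blast
  qed
  have Inf_le: "Inf I \<le> l" if "bdd_below I" "l \<in> I" for l
    using that by (rule cInf_lower[rotated])
  have le_Sup: "l \<le> Sup I" if "bdd_above I" "l \<in> I" for l
    using that by (rule cSup_upper[rotated])
  \<comment> \<open>An interval that omits \<open>l0\<close> lies on one side of it; the side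
    decides between \<open>p1\<close> and \<open>p2\<close>.\<close>
  have "l0 \<notin> C x0" using CN x0 by blast
  then have "C x0 \<subseteq> {l0<..} \<or> C x0 \<subseteq> {..<l0}"
    using mem_is_interval_1_I[OF C_interval[OF x0(1)], of _ _ l0] by (force simp: not_less)
  then consider "C x0 \<subseteq> {l0<..}" | "C x0 \<subseteq> {..<l0}" by blast
  then show ?thesis
  proof cases
    case 1
    obtain a b x where *: "l0 < a" "a < b" "{a..b} \<subseteq> I" "x \<in> X" "l0 \<notin> C x" "a \<notin> C x"
        "{a<..<b} \<subseteq> C x" "\<forall>y\<in>X. C y \<inter> {a<..<b} \<noteq> {} \<longrightarrow> a \<notin> N y"
      using extremal_interval_right[OF I C_interval C_open C_ne N_open CN l0_in D fip' x0 1]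
      by blast
    have "a \<in> I" using * by auto
    \<comment> \<open>Since \<open>a\<close> is a point of \<open>I\<close> beyond
      \<open>l0\<close>, the clause demanding \<open>p2\<close> is vacuous here; the clause
      demanding \<open>p1\<close> holds because \<open>p1\<close> does.\<close>
    have "\<not> (bdd_above I \<and> l0 = Sup I)" using le_Sup \<open>a \<in> I\<close> * by force
    moreover have "G x l0 \<inter> E \<noteq> {}" "G x a \<inter> E \<noteq> {}"
      using * notC l0_in \<open>a \<in> I\<close> by blast+
    moreover have "\<forall>l\<in>{a<..<b}. G x l \<subseteq> UNIV - E" using * by (auto simp: C_def)
    ultimately show ?thesis
      using *(1-4) frontiers[OF \<open>a \<in> I\<close> refl *(3) *(8)] unfolding Let_def
      by (intro exI[of _ a] exI[of _ b] exI[of _ x] conjI) simp_all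
  next
    case 2
    obtain a b x where *: "b < l0" "a < b" "{a..b} \<subseteq> I" "x \<in> X" "l0 \<notin> C x" "b \<notin> C x"
        "{a<..<b} \<subseteq> C x" "\<forall>y\<in>X. C y \<inter> {a<..<b} \<noteq> {} \<longrightarrow> b \<notin> N y"
      using extremal_interval_left[OF I C_interval C_open C_ne N_open CN l0_in D fip' x0 2]
      by blast
    have "b \<in> I" using * by auto
    have "\<not> (bdd_below I \<and> l0 = Inf I)" using Inf_le \<open>b \<in> I\<close> * by force
    moreover have "G x l0 \<inter> E \<noteq> {}" "G x b \<inter> E \<noteq> {}"
      using * notC l0_in \<open>b \<in> I\<close> by blast+
    moreover have "\<forall>l\<in>{a<..<b}. G x l \<subseteq> UNIV - E" using * by (auto simp: C_def)
    ultimately show ?thesis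
      using *(1-4) frontiers[OF \<open>b \<in> I\<close> refl *(3) *(8)] unfolding Let_def
      by (intro exI[of _ a] exI[of _ b] exI[of _ x] conjI) simp_all
  qed
qed

end
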